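(* Let $W$ be a standard one-dimensional Brownian motion on $[0,1]$ and let $S_t=e^{W_t-t/2}$, $t\in[0,1]$, so that $S_t=1+\int_0^tS_s\,dW_s$. For $n\ge1$ let $S_1^E=S_1^{E,n}$ be the Euler approximation of $S_1$ corresponding to the equidistant partition $(i/n)_{i=0}^n$ of $[0,1]$. Then there exists $K_0>0$ such that $$\liminf_{n\to\infty}\sqrt n\,\sup_{K\ge K_0}\mathbb E\big|\chi_{[K,\infty)}(S_1)-\chi_{[K,\infty)}(S_1^E)\big|>0.$$
   Context: The Euler approximation for $dS_t=S_t\,dW_t$, $S_0=1$, relative to $(i/n)_{i=0}^n$ is given by $S_0^E=1$ and $S^E_{(i+1)/n}=S^E_{i/n}+S^E_{i/n}\,(W_{(i+1)/n}-W_{i/n})$, $i=0,\dots,n-1$. $\chi_A$ is the indicator function of $A$. *)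

theory Defs
  imports "HOL-Probability.Probability"
begin

text \<open>
  Standard one-dimensional Brownian motion on the time interval \<open>[0,1]\<close>. The process is a
  function of real time; nothing is required outside \<open>[0,1]\<close>. The initial value and path
  continuity are only required almost surely.
\<close>

locale standard_brownian_motion = prob_space M
  for M :: "'a measure" +
  fixes W :: "real \<Rightarrow> 'a \<Rightarrow> real"
  assumes random_variable_W: "\<And>t. t \<in> {0..1} \<Longrightarrow> random_variable borel (W t)"
    and start_at_0: "AE \<omega> in M. W 0 \<omega> = 0"
    and independent_increments:
      "\<And>(t :: nat \<Rightarrow> real) k. 0 \<le> t 0 \<Longrightarrow> strict_mono_on {..k} t \<Longrightarrow> t k \<le> 1 \<Longrightarrow>
         indep_vars (\<lambda>_. borel) (\<lambda>i \<omega>. W (t (Suc i)) \<omega> - W (t i) \<omega>) {..<k}"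
    and gaussian_increments:
      "\<And>s t. 0 \<le> s \<Longrightarrow> s < t \<Longrightarrow> t \<le> 1 \<Longrightarrow>
         distributed M lborel (\<lambda>\<omega>. W t \<omega> - W s \<omega>) (normal_density 0 (sqrt (t - s)))"
    and continuous_paths: "AE \<omega> in M. continuous_on {0..1} (\<lambda>t. W t \<omega>)"

definition geometric_BM :: "(real \<Rightarrow> 'a \<Rightarrow> real) \<Rightarrow> real \<Rightarrow> 'a \<Rightarrow> real" where
  "geometric_BM W t \<omega> = exp (W t \<omega> - t / 2)"

text \<open>
  \<open>euler_S W n i\<close> is the value at time \<open>i/n\<close> of the Euler scheme for \<open>dS = S dW\<close>, \<open>S\<^sub>0 = 1\<close>, relative
  to the partition \<open>(i/n)\<close> of \<open>[0,1]\<close>; it is meaningful for \<open>n \<ge> 1\<close> and \<open>i \<le> n\<close>. Its terminal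
  value is \<open>euler_S W n n\<close>.
\<close>

primrec euler_S :: "(real \<Rightarrow> 'a \<Rightarrow> real) \<Rightarrow> nat \<Rightarrow> nat \<Rightarrow> 'a \<Rightarrow> real" where
  "euler_S W n 0 \<omega> = 1"
| "euler_S W n (Suc i) \<omega> =
     euler_S W n i \<omega> + euler_S W n i \<omega> * (W (real (Suc i) / real n) \<omega> - W (real i / real n) \<omega>)"

end

theory Submission
  imports Defs "HOL-Real_Asymp.Real_Asymp"
begin

text \<open>
  Let \<open>D = S\<^sub>1 - S\<^sub>1\<^sup>E\<close>. The supremum over \<open>K\<close> dominates any average over \<open>K\<close>, and averaging the
  threshold discrepancy over \<open>[K\<^sub>0, K\<^sub>0 + L]\<close> gives, by Fubini, an expectation that is at least
  \<open>\<bar>D\<bar> / L\<close> on the event that both variables lie in this interval. The mixed moments of \<open>S\<^sub>1\<close> and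
  \<open>S\<^sub>1\<^sup>E\<close> factorise over the independent increments and are explicit Gaussian integrals, so
  \<open>n E D\<^sup>2\<close> converges to \<open>e / 2\<close>, while \<open>n\<^sup>2 E D\<^sup>4\<close> stays bounded. Hence \<open>E \<bar>D\<bar>\<close> is of
  order at least \<open>n\<close> to the power \<open>-1/2\<close>, and a suitable choice of \<open>K\<^sub>0\<close> and \<open>L\<close> makes the
  excluded part negligible.
\<close>

section \<open>One-step Gaussian integrals: shifted moments and exponential tilting\<close>

text \<open>Expand (1 + x)^j binomially around 1 + \<mu> and insert the central moments. The factor
  1 + x is one step of the Euler product; powers up to 4 suffice for the fourth moment of the error,
  and a nonzero mean \<mu> arises from weighting with a power of
  \<open>geometric_BM\<close>.\<close>

lemma normal_moments_shifted:
  fixes \<mu> \<sigma> :: real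
  assumes \<sigma>: "0 < \<sigma>"
  shows "has_bochner_integral lborel (\<lambda>x. normal_density \<mu> \<sigma> x * (1 + x) ^ 0) 1"
    and "has_bochner_integral lborel (\<lambda>x. normal_density \<mu> \<sigma> x * (1 + x) ^ 1) (1 + \<mu>)"
    and "has_bochner_integral lborel (\<lambda>x. normal_density \<mu> \<sigma> x * (1 + x) ^ 2) ((1 + \<mu>)\<^sup>2 + \<sigma>\<^sup>2)"
    and "has_bochner_integral lborel (\<lambda>x. normal_density \<mu> \<sigma> x * (1 + x) ^ 3)
           ((1 + \<mu>) ^ 3 + 3 * (1 + \<mu>) * \<sigma>\<^sup>2)"
    and "has_bochner_integral lborel (\<lambda>x. normal_density \<mu> \<sigma> x * (1 + x) ^ 4)
           ((1 + \<mu>) ^ 4 + 6 * (1 + \<mu>)\<^sup>2 * \<sigma>\<^sup>2 + 3 * \<sigma> ^ 4)"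
proof -
  let ?N = "\<lambda>i x. normal_density \<mu> \<sigma> x * (x - \<mu>) ^ i"
  have c: "has_bochner_integral lborel (?N 0) 1" "has_bochner_integral lborel (?N 1) 0"
    "has_bochner_integral lborel (?N 2) (\<sigma>\<^sup>2)" "has_bochner_integral lborel (?N 3) 0"
    "has_bochner_integral lborel (?N 4) (3 * \<sigma> ^ 4)"
    using normal_moment_even[OF \<sigma>, of \<mu> 0] normal_moment_even[OF \<sigma>, of \<mu> 1]
      normal_moment_even[OF \<sigma>, of \<mu> 2] normal_moment_odd[OF \<sigma>, of \<mu> 0]
      normal_moment_odd[OF \<sigma>, of \<mu> 1]
    by (simp_all add: fact_numeral eval_nat_numeral mult_ac)
  note a = has_bochner_integral_add and m = has_bochner_integral_mult_right
  show "has_bochner_integral lborel (\<lambda>x. normal_density \<mu> \<sigma> x * (1 + x) ^ 0) 1"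
    using c(1) by simp
  show "has_bochner_integral lborel (\<lambda>x. normal_density \<mu> \<sigma> x * (1 + x) ^ 1) (1 + \<mu>)"
    by (rule has_bochner_integral_cong[THEN iffD1, OF _ _ _
          a[OF m[OF c(1), of "1 + \<mu>"] c(2)]]) (auto simp: algebra_simps)
  show "has_bochner_integral lborel (\<lambda>x. normal_density \<mu> \<sigma> x * (1 + x) ^ 2) ((1 + \<mu>)\<^sup>2 + \<sigma>\<^sup>2)"
    by (rule has_bochner_integral_cong[THEN iffD1, OF _ _ _
          a[OF a[OF m[OF c(1), of "(1 + \<mu>)\<^sup>2"] m[OF c(2), of "2 * (1 + \<mu>)"]] c(3)]])
       (auto simp: algebra_simps power2_eq_square)
  show "has_bochner_integral lborel (\<lambda>x. normal_density \<mu> \<sigma> x * (1 + x) ^ 3)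
           ((1 + \<mu>) ^ 3 + 3 * (1 + \<mu>) * \<sigma>\<^sup>2)"
    by (rule has_bochner_integral_cong[THEN iffD1, OF _ _ _
          a[OF a[OF a[OF m[OF c(1), of "(1 + \<mu>) ^ 3"] m[OF c(2), of "3 * (1 + \<mu>)\<^sup>2"]]
             m[OF c(3), of "3 * (1 + \<mu>)"]] c(4)]])
       (auto simp: algebra_simps eval_nat_numeral)
  show "has_bochner_integral lborel (\<lambda>x. normal_density \<mu> \<sigma> x * (1 + x) ^ 4)
           ((1 + \<mu>) ^ 4 + 6 * (1 + \<mu>)\<^sup>2 * \<sigma>\<^sup>2 + 3 * \<sigma> ^ 4)"
    by (rule has_bochner_integral_cong[THEN iffD1, OF _ _ _
          a[OF a[OF a[OF a[OF m[OF c(1), of "(1 + \<mu>) ^ 4"] m[OF c(2), of "4 * (1 + \<mu>) ^ 3"]]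
             m[OF c(3), of "6 * (1 + \<mu>)\<^sup>2"]] m[OF c(4), of "4 * (1 + \<mu>)"]] c(5)]])
       (auto simp: algebra_simps eval_nat_numeral)
qed

text \<open>Completing the square: one step of the exponential martingale, raised to the power
  \<open>a\<close>, only shifts the Gaussian mean, which is Cameron-Martin in dimension one.
  Integrals against powers of \<open>geometric_BM\<close> thereby become moments of a shifted normal
  law.\<close>

lemma normal_density_tilt:
  fixes \<sigma> a x :: real
  assumes "0 < \<sigma>"
  shows "normal_density 0 \<sigma> x * exp (a * (x - \<sigma>\<^sup>2 / 2))
    = exp ((a\<^sup>2 - a) * \<sigma>\<^sup>2 / 2) * normal_density (a * \<sigma>\<^sup>2) \<sigma> x"
proof -
  have "- x\<^sup>2 / (2 * \<sigma>\<^sup>2) + a * (x - \<sigma>\<^sup>2 / 2)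
      = (a\<^sup>2 - a) * \<sigma>\<^sup>2 / 2 + - (x - a * \<sigma>\<^sup>2)\<^sup>2 / (2 * \<sigma>\<^sup>2)"
    using assms by (simp add: field_simps power2_eq_square)
  then show ?thesis
    by (simp add: normal_density_def flip: exp_add)
qed

lemma has_bochner_integral_normal_tilt:
  fixes \<sigma> a m :: real and f :: "real \<Rightarrow> real"
  assumes "0 < \<sigma>" and "has_bochner_integral lborel (\<lambda>x. normal_density (a * \<sigma>\<^sup>2) \<sigma> x * f x) m"
  shows "has_bochner_integral lborel
    (\<lambda>x. normal_density 0 \<sigma> x * (exp (a * (x - \<sigma>\<^sup>2 / 2)) * f x)) (exp ((a\<^sup>2 - a) * \<sigma>\<^sup>2 / 2) * m)"
proof -
  have "normal_density 0 \<sigma> x * (exp (a * (x - \<sigma>\<^sup>2 / 2)) * f x)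
      = exp ((a\<^sup>2 - a) * \<sigma>\<^sup>2 / 2) * (normal_density (a * \<sigma>\<^sup>2) \<sigma> x * f x)" for x
    using normal_density_tilt[OF assms(1), of x a] by (metis mult.assoc)
  then show ?thesis
    using has_bochner_integral_mult_right[OF assms(2), of "exp ((a\<^sup>2 - a) * \<sigma>\<^sup>2 / 2)"]
    by (simp only:)
qed

section \<open>Exact mixed moments of the solution and its Euler approximation\<close>

lemma euler_S_eq_prod:
  "euler_S W n k \<omega> = (\<Prod>i<k. 1 + (W (real (Suc i) / real n) \<omega> - W (real i / real n) \<omega>))"
  by (induction k) (simp_all add: algebra_simps)

context standard_brownian_motion
begin

lemma geometric_BM_measurable [measurable]: "random_variable borel (geometric_BM W 1)"
  unfolding geometric_BM_def using random_variable_W[of 1] by measurable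

lemma euler_S_measurable: "k \<le> n \<Longrightarrow> random_variable borel (euler_S W n k)"
  unfolding euler_S_eq_prod[abs_def]
  by (intro borel_measurable_prod borel_measurable_add borel_measurable_diff random_variable_W)
    (auto simp: field_simps)

text \<open>Both factors are products over the same n independent, identically distributed
  increments, so the expectation is the n-th power of a one-step integral; tilting moves its mean to
  \<open>a / real n\<close>. The exponent \<open>a\<close> is real so that \<open>a = -1\<close> is
  covered too.\<close>

lemma has_bochner_integral_gbm_euler:
  fixes a m :: real
  assumes n: "0 < n"
    and m: "has_bochner_integral lborel
      (\<lambda>x. normal_density (a / real n) (sqrt (1 / real n)) x * (1 + x) ^ j) m"
  shows "has_bochner_integral M (\<lambda>\<omega>. geometric_BM W 1 \<omega> powr a * euler_S W n n \<omega> ^ j)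
    ((exp ((a\<^sup>2 - a) / (2 * real n)) * m) ^ n)"
proof -
  define m' where "m' = exp ((a\<^sup>2 - a) / (2 * real n)) * m"
  define t where "t i = real i / real n" for i
  define \<Delta> where "\<Delta> i \<omega> = W (t (Suc i)) \<omega> - W (t i) \<omega>" for i \<omega>
  define g where "g x = exp (a * (x - 1 / (2 * real n))) * (1 + x) ^ j" for x
  have g_meas [measurable]: "g \<in> borel_measurable borel"
    unfolding g_def by measurable
  have "indep_vars (\<lambda>_. borel) \<Delta> {..<n}"
    unfolding \<Delta>_def using n
    by (intro independent_increments) (auto simp: t_def strict_mono_on_def divide_strict_right_mono)
  then have indep: "indep_vars (\<lambda>_. borel) (\<lambda>i \<omega>. g (\<Delta> i \<omega>)) {..<n}"
    by (rule indep_vars_compose2) simp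
  have D: "distributed M lborel (\<Delta> i) (normal_density 0 (sqrt (1 / real n)))" if "i < n" for i
  proof -
    have "t (Suc i) - t i = 1 / real n"
      by (simp add: t_def flip: diff_divide_distrib)
    moreover have "distributed M lborel (\<Delta> i) (normal_density 0 (sqrt (t (Suc i) - t i)))"
      unfolding \<Delta>_def using that
      by (intro gaussian_increments) (auto simp: t_def field_simps)
    ultimately show ?thesis
      by simp
  qed
  have m': "has_bochner_integral lborel (\<lambda>x. normal_density 0 (sqrt (1 / real n)) x * g x) m'"
    using has_bochner_integral_normal_tilt[of "sqrt (1 / real n)" a "\<lambda>x. (1 + x) ^ j" m] m n
    by (simp add: g_def m'_def mult_ac)
  have int: "integrable M (\<lambda>\<omega>. g (\<Delta> i \<omega>))" and E: "expectation (\<lambda>\<omega>. g (\<Delta> i \<omega>)) = m'"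
    if "i < n" for i
    using distributed_integrable[OF D[OF that], of g] distributed_integral[OF D[OF that], of g] m'
    by (auto simp: has_bochner_integral_iff)
  have "has_bochner_integral M (\<lambda>\<omega>. \<Prod>i<n. g (\<Delta> i \<omega>)) (m' ^ n)"
    unfolding has_bochner_integral_iff
    using indep_vars_integrable[OF _ indep] indep_vars_lebesgue_integral[OF _ indep] int E by simp
  \<comment> \<open>Only almost surely: the increments telescope to \<open>W 1 - W 0\<close>, and
    \<open>W 0\<close> vanishes just outside a null set.\<close>
  moreover have "AE \<omega> in M. (\<Prod>i<n. g (\<Delta> i \<omega>)) = geometric_BM W 1 \<omega> powr a * euler_S W n n \<omega> ^ j"
    using start_at_0
  proof eventually_elim
    case (elim \<omega>)
    have "(\<Sum>i<n. \<Delta> i \<omega>) = W 1 \<omega>"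
      using elim n unfolding \<Delta>_def by (subst sum_lessThan_telescope) (simp add: t_def)
    then have "(\<Sum>i<n. a * (\<Delta> i \<omega> - 1 / (2 * real n))) = a * (W 1 \<omega> - 1 / 2)"
      using n by (simp add: sum_subtractf flip: sum_distrib_left)
    then have "(\<Prod>i<n. exp (a * (\<Delta> i \<omega> - 1 / (2 * real n)))) = geometric_BM W 1 \<omega> powr a"
      by (simp add: geometric_BM_def powr_def flip: exp_sum)
    moreover have "(\<Prod>i<n. (1 + \<Delta> i \<omega>) ^ j) = euler_S W n n \<omega> ^ j"
      by (simp add: euler_S_eq_prod \<Delta>_def t_def flip: prod_power_distrib)
    ultimately show ?case
      unfolding g_def prod.distrib by simp
  qed
  moreover have "(\<lambda>\<omega>. geometric_BM W 1 \<omega> powr a * euler_S W n n \<omega> ^ j) \<in> borel_measurable M"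
    using euler_S_measurable[of n n] by measurable
  ultimately show ?thesis
    unfolding m'_def[symmetric]
    by (subst has_bochner_integral_cong_AE[symmetric]) (auto dest: has_bochner_integral_iff[THEN iffD1])
qed


text \<open>A single step (n = 1) with Euler exponent 0 leaves a pure moment of
  \<open>geometric_BM\<close>. The first moment will control large values of the solution, the
  inverse moment values near 0.\<close>

lemma has_bochner_integral_gbm:
  shows "has_bochner_integral M (geometric_BM W 1) 1"
    and "has_bochner_integral M (\<lambda>\<omega>. inverse (geometric_BM W 1 \<omega>)) (exp 1)"
proof -
  have pos: "0 < geometric_BM W 1 \<omega>" for \<omega>
    by (simp add: geometric_BM_def)
  note N = normal_moments_shifted(1)[where \<sigma> = 1, simplified]
  show "has_bochner_integral M (geometric_BM W 1) 1"
    using has_bochner_integral_gbm_euler[of 1 1 0 1] N[of 1] pos by (simp add: less_imp_le)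
  show "has_bochner_integral M (\<lambda>\<omega>. inverse (geometric_BM W 1 \<omega>)) (exp 1)"
    using has_bochner_integral_gbm_euler[of 1 "-1" 0 1] N[of "-1"] pos
    by (simp add: powr_minus less_imp_le)
qed

text \<open>Expand the power of the difference and insert the mixed moments. In the second moment,
  the cross moment and the second moment of the Euler value coincide, which leaves just two
  terms.\<close>

lemma has_bochner_integral_euler_error:
  fixes n :: nat
  assumes n: "0 < n"
  shows "has_bochner_integral M (\<lambda>\<omega>. (geometric_BM W 1 \<omega> - euler_S W n n \<omega>) ^ 2)
      (exp 1 - (1 + 1 / real n) ^ n)" (is ?D2)
    and "has_bochner_integral M (\<lambda>\<omega>. (geometric_BM W 1 \<omega> - euler_S W n n \<omega>) ^ 4)
      (exp 6 - 4 * (exp (3 / real n) * (1 + 3 / real n)) ^ n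
        + 6 * (exp (1 / real n) * ((1 + 2 / real n)\<^sup>2 + 1 / real n)) ^ n
        - 4 * ((1 + 1 / real n) ^ 3 + 3 * (1 + 1 / real n) * (1 / real n)) ^ n
        + (1 + 6 / real n + 3 / (real n)\<^sup>2) ^ n)" (is ?D4)
proof -
  define \<sigma> where "\<sigma> = sqrt (1 / real n)"
  have \<sigma>: "0 < \<sigma>" "\<sigma>\<^sup>2 = 1 / real n" "\<sigma> ^ 4 = 1 / (real n)\<^sup>2"
  proof -
    show "0 < \<sigma>" "\<sigma>\<^sup>2 = 1 / real n"
      using n by (simp_all add: \<sigma>_def)
    then have "(\<sigma>\<^sup>2)\<^sup>2 = 1 / (real n)\<^sup>2"
      by (simp add: power_divide)
    then show "\<sigma> ^ 4 = 1 / (real n)\<^sup>2"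
      by simp
  qed
  let ?S = "geometric_BM W 1" and ?E = "euler_S W n n"
  have mom: "has_bochner_integral M (\<lambda>\<omega>. ?S \<omega> ^ k * ?E \<omega> ^ j)
      ((exp ((real k ^ 2 - real k) / (2 * real n)) * m) ^ n)"
    if "has_bochner_integral lborel (\<lambda>x. normal_density (real k / real n) \<sigma> x * (1 + x) ^ j) m" for k j m
  proof -
    have "?S \<omega> powr real k = ?S \<omega> ^ k" for \<omega>
      by (simp add: geometric_BM_def powr_realpow)
    then show ?thesis
      using has_bochner_integral_gbm_euler[OF n that[unfolded \<sigma>_def]] by simp
  qed
  note N = normal_moments_shifted[OF \<sigma>(1)]
  have M2: "has_bochner_integral M (\<lambda>\<omega>. ?S \<omega> ^ 2) (exp 1)"
    using mom[OF N(1), of 2] n by (simp flip: exp_of_nat_mult)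
  have M11: "has_bochner_integral M (\<lambda>\<omega>. ?S \<omega> * ?E \<omega>) ((1 + 1 / real n) ^ n)"
    using mom[OF N(2), of 1] by (simp add: \<sigma>)
  have M02: "has_bochner_integral M (\<lambda>\<omega>. ?E \<omega> ^ 2) ((1 + 1 / real n) ^ n)"
    using mom[OF N(3), of 0] by (simp add: \<sigma>)
  have M4: "has_bochner_integral M (\<lambda>\<omega>. ?S \<omega> ^ 4) (exp 6)"
    using mom[OF N(1), of 4] n by (simp flip: exp_of_nat_mult)
  have M31: "has_bochner_integral M (\<lambda>\<omega>. ?S \<omega> ^ 3 * ?E \<omega>) ((exp (3 / real n) * (1 + 3 / real n)) ^ n)"
    using mom[OF N(2), of 3] by (simp add: \<sigma>)
  have M22: "has_bochner_integral M (\<lambda>\<omega>. ?S \<omega> ^ 2 * ?E \<omega> ^ 2)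
      ((exp (1 / real n) * ((1 + 2 / real n)\<^sup>2 + 1 / real n)) ^ n)"
    using mom[OF N(3), of 2] by (simp add: \<sigma>)
  have M13: "has_bochner_integral M (\<lambda>\<omega>. ?S \<omega> * ?E \<omega> ^ 3)
      (((1 + 1 / real n) ^ 3 + 3 * (1 + 1 / real n) * (1 / real n)) ^ n)"
    using mom[OF N(4), of 1] by (simp add: \<sigma>)
  have M04: "has_bochner_integral M (\<lambda>\<omega>. ?E \<omega> ^ 4) ((1 + 6 / real n + 3 / (real n)\<^sup>2) ^ n)"
    using mom[OF N(5), of 0] by (simp add: \<sigma>)
  note add = has_bochner_integral_add and diff = has_bochner_integral_diff
    and mult = has_bochner_integral_mult_right
  show ?D2
    by (rule has_bochner_integral_cong[THEN iffD1, OF _ _ _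
          add[OF diff[OF M2 mult[OF M11, of 2]] M02]])
       (auto simp: algebra_simps power2_eq_square)
  show ?D4
    by (rule has_bochner_integral_cong[THEN iffD1, OF _ _ _
          add[OF diff[OF add[OF diff[OF M4 mult[OF M31, of 4]] mult[OF M22, of 6]]
              mult[OF M13, of 4]] M04]])
       (auto simp: algebra_simps eval_nat_numeral)
qed

end

section \<open>Asymptotics of the error moments\<close>

text \<open>The first limit is the 1/n term of (1 + 1/n)^n. In the second expression all five
  moments tend to e^6 with weights 1, -4, 6, -4, 1; both the constant terms and the 1/n terms
  cancel.\<close>

lemma euler_error_asymptotics:
  shows "(\<lambda>n. real n * (exp 1 - (1 + 1 / real n) ^ n)) \<longlonglongrightarrow> exp 1 / 2"
    and "(\<lambda>n. (real n)\<^sup>2 * (exp 6 - 4 * (exp (3 / real n) * (1 + 3 / real n)) ^ n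
        + 6 * (exp (1 / real n) * ((1 + 2 / real n)\<^sup>2 + 1 / real n)) ^ n
        - 4 * ((1 + 1 / real n) ^ 3 + 3 * (1 + 1 / real n) * (1 / real n)) ^ n
        + (1 + 6 / real n + 3 / (real n)\<^sup>2) ^ n)) \<in> O(\<lambda>_. 1)"
  by real_asymp+

section \<open>Averaging over thresholds and truncation\<close>

text \<open>The thresholds separating two numbers form a half-open interval whose length is their
  distance, so Tonelli turns the integral over K of the discrepancies into an expected distance. A
  signed minorant \<open>R\<close> replaces the truncated distance, so that its expectation can be
  computed explicitly.\<close>

lemma (in prob_space) expectation_le_threshold_discrepancy:
  fixes X Y R :: "'a \<Rightarrow> real"
  assumes [measurable]: "random_variable borel X" "random_variable borel Y"
    and R: "integrable M R"
    and R_le: "\<And>\<omega>. R \<omega> \<le> \<bar>X \<omega> - Y \<omega>\<bar>"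
    and R_out: "\<And>\<omega>. \<not> (X \<omega> \<in> {a..b} \<and> Y \<omega> \<in> {a..b}) \<Longrightarrow> R \<omega> \<le> 0"
    and ab: "a \<le> b" and B: "0 \<le> B"
    and disc: "\<And>K. K \<in> {a..b} \<Longrightarrow>
      expectation (\<lambda>\<omega>. \<bar>indicator {K..} (X \<omega>) - indicator {K..} (Y \<omega>)\<bar>) \<le> B"
  shows "expectation R \<le> B * (b - a)"
proof -
  interpret P: pair_sigma_finite M lborel ..
  \<comment> \<open>Writing the discrepancy by order relations makes it jointly measurable in the
    outcome and the threshold, as Tonelli requires.\<close>
  define h :: "'a \<Rightarrow> real \<Rightarrow> real"
    where "h \<omega> K = (if X \<omega> < K \<and> K \<le> Y \<omega> \<or> Y \<omega> < K \<and> K \<le> X \<omega> then 1 else 0)" for \<omega> K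
  have [measurable]: "(\<lambda>(\<omega>, K). h \<omega> K) \<in> borel_measurable (M \<Otimes>\<^sub>M borel)"
    unfolding h_def by measurable
  have h_eq: "h \<omega> K = \<bar>indicator {K..} (X \<omega>) - indicator {K..} (Y \<omega>)\<bar>" for \<omega> K
    by (auto simp: h_def indicator_def)
  have "ennreal (R \<omega>) \<le> (\<integral>\<^sup>+K. ennreal (h \<omega> K) * indicator {a..b} K \<partial>lborel)" for \<omega>
  proof (cases "X \<omega> \<in> {a..b} \<and> Y \<omega> \<in> {a..b}")
    case True
    have "ennreal (R \<omega>) \<le> ennreal \<bar>X \<omega> - Y \<omega>\<bar>"
      using R_le by (rule ennreal_leI)
    also have "\<dots> = emeasure lborel {min (X \<omega>) (Y \<omega>)<..max (X \<omega>) (Y \<omega>)}"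
      by (subst emeasure_lborel_Ioc) (auto simp: max_def min_def)
    also have "\<dots> = (\<integral>\<^sup>+K. indicator {min (X \<omega>) (Y \<omega>)<..max (X \<omega>) (Y \<omega>)} K \<partial>lborel)"
      by simp
    also have "\<dots> \<le> (\<integral>\<^sup>+K. ennreal (h \<omega> K) * indicator {a..b} K \<partial>lborel)"
      using True by (intro nn_integral_mono) (auto simp: h_def indicator_def)
    finally show ?thesis .
  next
    case False
    then show ?thesis
      using R_out by (simp add: ennreal_neg)
  qed
  then have "(\<integral>\<^sup>+\<omega>. ennreal (R \<omega>) \<partial>M)
      \<le> (\<integral>\<^sup>+\<omega>. (\<integral>\<^sup>+K. ennreal (h \<omega> K) * indicator {a..b} K \<partial>lborel) \<partial>M)"
    by (intro nn_integral_mono)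
  also have "\<dots> = (\<integral>\<^sup>+K. (\<integral>\<^sup>+\<omega>. ennreal (h \<omega> K) * indicator {a..b} K \<partial>M) \<partial>lborel)"
    by (rule P.Fubini'[symmetric]) measurable
  also have "\<dots> \<le> (\<integral>\<^sup>+K. ennreal B * indicator {a..b} K \<partial>lborel)"
  proof (rule nn_integral_mono)
    fix K :: real
    have "integrable M (\<lambda>\<omega>. h \<omega> K)"
      by (rule integrable_const_bound[of _ 1]) (auto simp: h_def)
    then have "(\<integral>\<^sup>+\<omega>. ennreal (h \<omega> K) \<partial>M) = ennreal (expectation (\<lambda>\<omega>. h \<omega> K))"
      by (rule nn_integral_eq_integral) (simp add: h_eq)
    moreover have "expectation (\<lambda>\<omega>. h \<omega> K) \<le> B" if "K \<in> {a..b}"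
      using disc[OF that] by (simp only: h_eq)
    ultimately show "(\<integral>\<^sup>+\<omega>. ennreal (h \<omega> K) * indicator {a..b} K \<partial>M) \<le> ennreal B * indicator {a..b} K"
      by (auto simp: indicator_def intro: ennreal_leI)
  qed
  also have "\<dots> = ennreal (B * (b - a))"
    using ab B by (simp add: nn_integral_cmult ennreal_mult)
  finally have le: "(\<integral>\<^sup>+\<omega>. ennreal (R \<omega>) \<partial>M) \<le> ennreal (B * (b - a))" .
  \<comment> \<open>\<open>ennreal\<close> cuts negative values to 0, so the right-hand side is the
    integral of the positive part; the negative part only lowers the expectation.\<close>
  have "expectation R \<le> enn2real (\<integral>\<^sup>+\<omega>. ennreal (R \<omega>) \<partial>M)"
    unfolding real_lebesgue_integral_def[OF R] by simp
  also have "\<dots> \<le> B * (b - a)"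
    using le ab B by (intro enn2real_leI) auto
  finally show ?thesis .
qed

text \<open>
  The first two terms of \<open>R\<close> bound \<open>\<bar>x - y\<bar>\<close> from below since \<open>u\<^sup>2 - u ^ 4 \<le> u\<close> for
  \<open>u = l * \<bar>x - y\<bar>\<close>. The remaining ones are the AM-GM bound for \<open>\<bar>x - y\<bar>\<close> times the indicator of
  the excluded event, the latter being estimated as in Markov's inequality; all expectations are
  then explicit.
\<close>

lemma truncated_abs_diff_bounds:
  fixes x y l m K L :: real
  assumes pos: "0 < x" "0 < K" "0 < L" "0 \<le> l" "0 < m"
  defines "R \<equiv> l * (x - y)\<^sup>2 - l ^ 3 * (x - y) ^ 4 - m / 2 * (x - y)\<^sup>2
    - 1 / (2 * m) * (1 / L * x + 2 * K * inverse x + (x - y)\<^sup>2 / K\<^sup>2)"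
  shows "R \<le> \<bar>x - y\<bar>"
    and "\<not> (x \<in> {K..K + L} \<and> y \<in> {K..K + L}) \<Longrightarrow> R \<le> 0"
proof -
  define d where "d = \<bar>x - y\<bar>"
  define q where "q = 1 / L * x + 2 * K * inverse x + d\<^sup>2 / K\<^sup>2"
  have d: "0 \<le> d" "(x - y)\<^sup>2 = d\<^sup>2" "(x - y) ^ 4 = d ^ 4"
    by (simp_all add: d_def power_even_abs)
  have R: "R = l * d\<^sup>2 - l ^ 3 * d ^ 4 - m / 2 * d\<^sup>2 - q / (2 * m)"
    by (simp add: R_def d q_def)
  have *: "l * d\<^sup>2 - l ^ 3 * d ^ 4 \<le> d"
  proof -
    \<comment> \<open>With u = l * d, expanding this product gives u - u^3 <= 1 - u^2 <= 1;
      multiplying by d yields the claim.\<close>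
    have "0 \<le> (l * d - 1)\<^sup>2 * (l * d + 1)"
      using pos d by simp
    moreover have "0 \<le> (l * d) ^ 3"
      using pos d by simp
    moreover have "(l * d - 1)\<^sup>2 * (l * d + 1) = (l * d) ^ 3 - (l * d)\<^sup>2 - l * d + 1"
      by (simp add: algebra_simps eval_nat_numeral)
    moreover have "0 \<le> (l * d)\<^sup>2"
      by simp
    ultimately have "l * d - (l * d) ^ 3 \<le> 1"
      by linarith
    from mult_left_mono[OF this d(1)] show ?thesis
      by (simp add: algebra_simps eval_nat_numeral)
  qed
  have q: "0 \<le> q"
    using pos by (simp add: q_def)
  show "R \<le> \<bar>x - y\<bar>"
  proof -
    have "0 \<le> m / 2 * d\<^sup>2" "0 \<le> q / (2 * m)"
      using pos q by simp_all
    then show ?thesis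
      using * unfolding R d_def[symmetric] by linarith
  qed
  assume out: "\<not> (x \<in> {K..K + L} \<and> y \<in> {K..K + L})"
  have "1 \<le> q"
  proof -
    \<comment> \<open>If 2K <= x <= L and d <= K, then y lies in [K, K + L] as well: the margin K on
      each side of x absorbs the distance. Each of the three failures makes one summand of
      \<open>q\<close> at least 1.\<close>
    have "x > L \<or> x < 2 * K \<or> d > K"
      using out pos unfolding d_def by auto
    then have "1 \<le> 1 / L * x \<or> 1 \<le> 2 * K * inverse x \<or> 1 \<le> d\<^sup>2 / K\<^sup>2"
      using pos by (auto simp: field_simps)
    moreover have "0 \<le> 1 / L * x" "0 \<le> 2 * K * inverse x" "0 \<le> d\<^sup>2 / K\<^sup>2"
      using pos by simp_all
    ultimately show ?thesis
      unfolding q_def by linarith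
  qed
  then have "1 / (2 * m) \<le> q / (2 * m)"
    using pos by (intro divide_right_mono) auto
  moreover have "d \<le> m / 2 * d\<^sup>2 + 1 / (2 * m)"
  proof -
    have "0 \<le> (m * d - 1)\<^sup>2 / (2 * m)"
      using pos by simp
    also have "\<dots> = m / 2 * d\<^sup>2 + 1 / (2 * m) - d"
      using pos by (simp add: field_simps power2_eq_square)
    finally show ?thesis
      by simp
  qed
  ultimately show "R \<le> 0"
    using * unfolding R by linarith
qed

section \<open>Choice of constants and conclusion\<close>

theorem theorem7p2:
  fixes M :: "'a measure" and W :: "real \<Rightarrow> 'a \<Rightarrow> real"
  assumes "standard_brownian_motion M W"
  shows "\<exists>K\<^sub>0>0.
    liminf (\<lambda>n. ereal (sqrt (real n)) *
      (SUP K\<in>{K\<^sub>0..}. ereal (prob_space.expectation M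
        (\<lambda>\<omega>. \<bar>indicator {K..} (geometric_BM W 1 \<omega>) - indicator {K..} (euler_S W n n \<omega>)\<bar>)))) > 0"
proof -
  interpret standard_brownian_motion M W by fact
  let ?S = "geometric_BM W 1" and ?E = "\<lambda>n. euler_S W n n"
  define p :: "nat \<Rightarrow> real \<Rightarrow> real" where
    "p n K = expectation (\<lambda>\<omega>. \<bar>indicator {K..} (?S \<omega>) - indicator {K..} (?E n \<omega>)\<bar>)"
    for n K
  define A where "A n = expectation (\<lambda>\<omega>. (?S \<omega> - ?E n \<omega>) ^ 2)" for n
  define B where "B n = expectation (\<lambda>\<omega>. (?S \<omega> - ?E n \<omega>) ^ 4)" for n
  have A_eq: "A n = exp 1 - (1 + 1 / real n) ^ n" if "0 < n" for n
    using has_bochner_integral_euler_error(1)[OF that] by (simp add: A_def has_bochner_integral_iff)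
  have A_lim: "(\<lambda>n. real n * A n) \<longlonglongrightarrow> exp 1 / 2"
    by (rule Lim_transform_eventually[OF euler_error_asymptotics(1)])
      (use eventually_gt_at_top[of 0] in eventually_elim, simp add: A_eq)
  have "(\<lambda>n. (real n)\<^sup>2 * B n) \<in> O(\<lambda>_. 1)"
  proof (rule landau_o.big.in_cong[THEN iffD1, OF _ euler_error_asymptotics(2)])
    show "\<forall>\<^sub>F n in sequentially. (real n)\<^sup>2 * (exp 6 - 4 * (exp (3 / real n) * (1 + 3 / real n)) ^ n
        + 6 * (exp (1 / real n) * ((1 + 2 / real n)\<^sup>2 + 1 / real n)) ^ n
        - 4 * ((1 + 1 / real n) ^ 3 + 3 * (1 + 1 / real n) * (1 / real n)) ^ n
        + (1 + 6 / real n + 3 / (real n)\<^sup>2) ^ n) = (real n)\<^sup>2 * B n"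
      using eventually_gt_at_top[of 0]
    proof eventually_elim
      case (elim n)
      show ?case
        using has_bochner_integral_euler_error(2)[OF elim] by (simp add: B_def has_bochner_integral_iff)
    qed
  qed
  then obtain C' where C': "\<forall>\<^sub>F n in sequentially. norm ((real n)\<^sup>2 * B n) \<le> C' * norm (1::real)"
    by (rule landau_o.bigE)
  define C where "C = max 1 C'"
  \<comment> \<open>The choice of s gives s^3 * C <= s/4. Those of \<open>K\<^sub>0\<close> and
    \<open>L\<close> make \<open>2 * K\<^sub>0 * exp 1\<close> and \<open>1 / L\<close> both equal
    to s^2/24.\<close>
  define s where "s = 1 / (2 * C)"
  define K\<^sub>0 where "K\<^sub>0 = s\<^sup>2 / (48 * exp 1)"
  define L where "L = 24 / s\<^sup>2"
  have C: "1 \<le> C"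
    by (simp add: C_def)
  have pos: "0 < s" "0 < K\<^sub>0" "0 < L"
    using C by (simp_all add: s_def K\<^sub>0_def L_def)
  have B_le: "\<forall>\<^sub>F n in sequentially. (real n)\<^sup>2 * B n \<le> C"
    using C' by eventually_elim (auto simp: C_def)
  \<comment> \<open>These bounds place the limit e/2 of n * A n strictly between 1 and 2.\<close>
  have e: "(2::real) < exp 1" "exp 1 < (4::real)"
    using exp_lower_Taylor_quadratic[of 1] exp_le by simp_all
  have A_ge: "\<forall>\<^sub>F n in sequentially. 1 \<le> real n * A n"
    using order_tendstoD(1)[OF A_lim, of 1] e by (auto elim: eventually_mono)
  have A_le: "\<forall>\<^sub>F n in sequentially. real n * A n \<le> 2"
    using order_tendstoD(2)[OF A_lim, of 2] e by (auto elim: eventually_mono)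
  have "(\<lambda>n. real n * A n * (1 / real n) / K\<^sub>0\<^sup>2) \<longlonglongrightarrow> exp 1 / 2 * 0 / K\<^sub>0\<^sup>2"
    using pos by (intro tendsto_intros A_lim lim_1_over_n) auto
  then have "\<forall>\<^sub>F n in sequentially. real n * A n * (1 / real n) / K\<^sub>0\<^sup>2 < s\<^sup>2 / 24"
    by (rule order_tendstoD) (use pos in simp)
  then have A_small: "\<forall>\<^sub>F n in sequentially. A n / K\<^sub>0\<^sup>2 < s\<^sup>2 / 24"
    using eventually_gt_at_top[of 0] by eventually_elim simp
  have "\<forall>\<^sub>F n in sequentially. ereal (s / (4 * L)) \<le> ereal (sqrt (real n)) * (SUP K\<in>{K\<^sub>0..}. ereal (p n K))"
    using A_ge A_le A_small B_le eventually_gt_at_top[of 0]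
  proof eventually_elim
    case (elim n)
    define r where "r = sqrt (real n)"
    have r: "0 < r" "r\<^sup>2 = real n"
      using elim by (simp_all add: r_def)
    \<comment> \<open>The error is of order 1/sqrt n, so both \<open>l\<close> and \<open>m\<close>
      scale like sqrt n. The ratio 1/4 makes the term with \<open>m / 2\<close> cost at most s/4,
      since n * A n <= 2.\<close>
    define l where "l = s * r"
    define m where "m = s / 4 * r"
    define R where "R \<omega> = l * (?S \<omega> - ?E n \<omega>)\<^sup>2 - l ^ 3 * (?S \<omega> - ?E n \<omega>) ^ 4 - m / 2 * (?S \<omega> - ?E n \<omega>)\<^sup>2
      - 1 / (2 * m) * (1 / L * ?S \<omega> + 2 * K\<^sub>0 * inverse (?S \<omega>) + (?S \<omega> - ?E n \<omega>)\<^sup>2 / K\<^sub>0\<^sup>2)" for \<omega>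
    have S_pos: "0 < ?S \<omega>" for \<omega>
      by (simp add: geometric_BM_def)
    have lm: "0 \<le> l" "0 < m"
      using pos r by (simp_all add: l_def m_def)
    have int2: "has_bochner_integral M (\<lambda>\<omega>. (?S \<omega> - ?E n \<omega>)\<^sup>2) (A n)"
      and int4: "has_bochner_integral M (\<lambda>\<omega>. (?S \<omega> - ?E n \<omega>) ^ 4) (B n)"
      using has_bochner_integral_euler_error[of n] elim(5)
      by (auto simp: A_def B_def has_bochner_integral_iff)
    have "has_bochner_integral M R (l * A n - l ^ 3 * B n - m / 2 * A n
        - 1 / (2 * m) * (1 / L * 1 + 2 * K\<^sub>0 * exp 1 + A n / K\<^sub>0\<^sup>2))"
      unfolding R_def
      by (intro has_bochner_integral_diff has_bochner_integral_add has_bochner_integral_mult_right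
          has_bochner_integral_divide_zero int2 int4 has_bochner_integral_gbm)
    then have R: "integrable M R" and ER: "expectation R = l * A n - l ^ 3 * B n - m / 2 * A n
        - 1 / (2 * m) * (1 / L + 2 * K\<^sub>0 * exp 1 + A n / K\<^sub>0\<^sup>2)"
      by (auto simp: has_bochner_integral_iff)
    have "s / 4 \<le> r * expectation R"
    proof -
      \<comment> \<open>After multiplication by sqrt n only the normalised moments n * A n and n^2 *
        B n remain. The main term is at least s and each of the three losses at most s/4, so s/4
        survives.\<close>
      have eq: "r * expectation R = s * (real n * A n) - s ^ 3 * ((real n)\<^sup>2 * B n) - s / 8 * (real n * A n)
          - 2 / s * (1 / L + 2 * K\<^sub>0 * exp 1 + A n / K\<^sub>0\<^sup>2)"
        using r(1) pos unfolding ER l_def m_def r(2)[symmetric]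
        by (simp add: field_simps eval_nat_numeral)
      have b1: "s * 1 \<le> s * (real n * A n)" and b2: "s / 8 * (real n * A n) \<le> s / 8 * 2"
        using elim pos by (auto intro!: mult_left_mono simp: mult_ac)
      have b3: "s ^ 3 * ((real n)\<^sup>2 * B n) \<le> s / 4"
      proof -
        have "s ^ 3 * ((real n)\<^sup>2 * B n) \<le> s ^ 3 * C"
          using elim pos by (auto intro!: mult_left_mono)
        also have "\<dots> = s / 4 * (1 / C)"
          using C by (simp add: s_def field_simps eval_nat_numeral)
        also have "\<dots> \<le> s / 4 * 1"
          using C pos by (intro mult_left_mono) auto
        finally show ?thesis
          by simp
      qed
      have "2 / s * (1 / L + 2 * K\<^sub>0 * exp 1 + A n / K\<^sub>0\<^sup>2) \<le> 2 / s * (s\<^sup>2 / 8)"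
        using elim pos by (intro mult_left_mono) (auto simp: L_def K\<^sub>0_def field_simps)
      also have "\<dots> = s / 4"
        using pos by (simp add: power2_eq_square)
      finally have b4: "2 / s * (1 / L + 2 * K\<^sub>0 * exp 1 + A n / K\<^sub>0\<^sup>2) \<le> s / 4" .
      have "s / 4 \<le> u - v - w - z" if "s * 1 \<le> u" "w \<le> s / 8 * 2" "v \<le> s / 4" "z \<le> s / 4"
        for u v w z
        using that by simp
      from this[OF b1 b2 b3 b4] show ?thesis
        unfolding eq .
    qed
    have p01: "0 \<le> p n K" "p n K \<le> 1" for K
    proof -
      have [measurable]: "random_variable borel (?E n)"
        by (rule euler_S_measurable) simp
      show "0 \<le> p n K"
        unfolding p_def by (rule Bochner_Integration.integral_nonneg) simp
      have "p n K \<le> expectation (\<lambda>_. 1)"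
        unfolding p_def by (rule integral_mono_AE')
          (auto simp: indicator_def)
      then show "p n K \<le> 1"
        by (simp add: prob_space)
    qed
    define b where "b = (SUP K\<in>{K\<^sub>0..}. ereal (p n K))"
    \<comment> \<open>All discrepancies lie in [0, 1], so the extended-real supremum is finite and
      can serve as the real bound in the averaging inequality.\<close>
    have "ereal (p n K\<^sub>0) \<le> b" "b \<le> 1"
      unfolding b_def using p01 by (auto intro: SUP_upper SUP_least)
    then obtain \<beta> where \<beta>: "b = ereal \<beta>" "0 \<le> \<beta>"
      using p01(1)[of K\<^sub>0] by (cases b) (auto intro: order_trans)
    have "p n K \<le> \<beta>" if "K \<in> {K\<^sub>0..K\<^sub>0 + L}" for K
    proof -
      have "ereal (p n K) \<le> b"
        unfolding b_def using that by (auto intro: SUP_upper)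
      then show ?thesis
        by (simp add: \<beta>)
    qed
    then have "expectation R \<le> \<beta> * (K\<^sub>0 + L - K\<^sub>0)"
      using pos R \<beta>(2) truncated_abs_diff_bounds[OF S_pos pos(2,3) lm] euler_S_measurable[of n n]
      unfolding p_def R_def
      by (intro expectation_le_threshold_discrepancy[of ?S "?E n"]) auto
    then have "r * expectation R \<le> r * (\<beta> * L)"
      using r by simp
    with \<open>s / 4 \<le> r * expectation R\<close> have "s / (4 * L) \<le> r * \<beta>"
      using pos by (simp add: field_simps)
    then show ?case
      by (simp flip: b_def r_def add: \<beta>)
  qed
  then have "ereal (s / (4 * L)) \<le> liminf (\<lambda>n. ereal (sqrt (real n)) * (SUP K\<in>{K\<^sub>0..}. ereal (p n K)))"
    by (rule Liminf_bounded)
  moreover have "0 < ereal (s / (4 * L))"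
    using pos by simp
  ultimately have "0 < liminf (\<lambda>n. ereal (sqrt (real n)) * (SUP K\<in>{K\<^sub>0..}. ereal (p n K)))"
    by (rule less_le_trans[rotated])
  with pos(2) show ?thesis
    unfolding p_def by blast
qed

end
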